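(* Let $G$ be a connected simple graph with vertices $v_1,\dots,v_n$ and let $B_G=(L_G+I_n)^{-1}=[b_{ij}]$. Let $v_i$ be a vertex and $v_j$ a vertex different from $v_i$. Then there exists a $v_jv_i$-path $v_j,v_{j_1},v_{j_2},\dots,v_{j_k},v_i$ in $G$ such that \[ b_{ij}<b_{i,j_1}<\cdots<b_{i,j_k}<b_{ii}. \] In particular $b_{ii}>b_{ij}$, so each diagonal entry of $B_G$ is strictly the largest entry in its row and in its column.
   Context: $L_G=D-A$ is the Laplacian matrix of $G$ ($A$ adjacency matrix, $D$ diagonal matrix of degrees), with row/column $i$ corresponding to vertex $v_i$; $L_G+I_n$ is positive definite, hence invertible, and $B_G$ is symmetric. *)

theory Defs
  imports
    "HOL-Analysis.Analysis"
    "Graph_Theory.Digraph"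
    "Graph_Theory.Digraph_Component"
    "Graph_Theory.Vertex_Walk"
begin

text \<open>
  A simple graph is a term satisfying the locale predicate \<^const>\<open>graph\<close>: a finite symmetric
  digraph without loops and parallel arcs, in which every undirected edge \<open>{x, y}\<close> is
  represented by the two arcs from \<open>x\<close> to \<open>y\<close> and from \<open>y\<close> to \<open>x\<close>.

  The vertices are listed by a bijection \<open>v\<close> from a finite index type \<open>'n\<close> onto the vertex set,
  so the number of vertices is \<open>CARD('n)\<close>, and row and column \<open>i\<close> of each matrix belong to
  the vertex \<open>v i\<close>.
\<close>

definition adjacency_matrix :: "('n::finite \<Rightarrow> 'a) \<Rightarrow> ('a, 'b) pre_digraph \<Rightarrow> real ^ 'n ^ 'n" where
  "adjacency_matrix v G = (\<chi> i j. if (v i, v j) \<in> arcs_ends G then 1 else 0)"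

text \<open>
  In a symmetric digraph without loops and parallel arcs, the out-degree of a vertex is its
  degree in the underlying undirected graph.
\<close>

definition degree_matrix :: "('n::finite \<Rightarrow> 'a) \<Rightarrow> ('a, 'b) pre_digraph \<Rightarrow> real ^ 'n ^ 'n" where
  "degree_matrix v G = (\<chi> i j. if i = j then real (out_degree G (v i)) else 0)"

definition laplacian_matrix :: "('n::finite \<Rightarrow> 'a) \<Rightarrow> ('a, 'b) pre_digraph \<Rightarrow> real ^ 'n ^ 'n" where
  "laplacian_matrix v G = degree_matrix v G - adjacency_matrix v G"

definition B_matrix :: "('n::finite \<Rightarrow> 'a) \<Rightarrow> ('a, 'b) pre_digraph \<Rightarrow> real ^ 'n ^ 'n" where
  "B_matrix v G = matrix_inv (laplacian_matrix v G + mat 1)"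

end

theory Submission
  imports Defs
begin

text \<open>
  Since \<open>(L + I) B = I\<close>, the column \<open>x\<close> of \<open>B\<close> at \<open>i\<close> satisfies
  \<open>x\<^sub>j + (\<Sum> (x\<^sub>j - x\<^sub>l)) = \<delta>\<^sub>i\<^sub>j\<close>, where the sum ranges over the neighbours \<open>l\<close> of \<open>j\<close>.
  Looking at a vertex where \<open>x\<close> is minimal gives \<open>x \<ge> 0\<close>. The zeros of \<open>x\<close> form a set that is
  closed under taking neighbours and misses \<open>i\<close>, so \<open>x > 0\<close> by connectedness. Hence for
  \<open>j \<noteq> i\<close> the sum is negative, and some neighbour of \<open>j\<close> has a larger value. Climbing to
  such a neighbour again and again can only stop at \<open>i\<close>.
\<close>

lemma matrix_inv_mult:
  fixes A :: "'a::semiring_1 ^ 'n ^ 'm"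
  assumes "invertible A"
  shows "A ** matrix_inv A = mat 1" "matrix_inv A ** A = mat 1"
proof -
  from assms have "\<exists>A'. A ** A' = mat 1 \<and> A' ** A = mat 1"
    by (simp add: invertible_def)
  from someI_ex[OF this] show "A ** matrix_inv A = mat 1" "matrix_inv A ** A = mat 1"
    by (simp_all add: matrix_inv_def)
qed

text \<open>Transposing \<open>matrix_inv A ** A = mat 1\<close> gives a right inverse of
  \<open>A\<close>, and a right inverse agrees with the left inverse.\<close>

lemma transpose_matrix_inv_symmetric:
  fixes A :: "'a::comm_semiring_1 ^ 'n ^ 'n"
  assumes "invertible A" "transpose A = A"
  shows "transpose (matrix_inv A) = matrix_inv A"
proof -
  have "A ** transpose (matrix_inv A) = mat 1"
    using arg_cong[OF matrix_inv_mult(2)[OF assms(1)], of transpose] assms(2)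
    by (simp add: matrix_transpose_mul)
  then have "matrix_inv A ** (A ** transpose (matrix_inv A)) = matrix_inv A"
    by simp
  then show ?thesis
    by (simp add: matrix_mul_assoc matrix_inv_mult(2)[OF assms(1)])
qed

locale indexed_graph = graph G for G :: "('a, 'b) pre_digraph" +
  fixes v :: "'n::finite \<Rightarrow> 'a"
  assumes bij_v: "bij_betw v UNIV (verts G)"
begin

definition neighbours :: "'n \<Rightarrow> 'n set" where
  "neighbours j = {l. v j \<rightarrow>\<^bsub>G\<^esub> v l}"

lemma inj_v: "inj v"
  using bij_v by (simp add: bij_betw_def)

lemma v_in_verts: "v j \<in> verts G"
  using bij_v by (auto simp: bij_betw_def)

text \<open>The degree counts arcs, the sums below run over indices. Without parallel arcs, an arc
  leaving \<open>v j\<close> is determined by its head.\<close>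

lemma out_degree_eq_card_neighbours: "out_degree G (v j) = card (neighbours j)"
proof -
  have "bij_betw (head G) (out_arcs G (v j)) (v ` neighbours j)"
    unfolding bij_betw_def
  proof
    show "inj_on (head G) (out_arcs G (v j))"
      by (rule inj_onI, rule no_multi_arcs) (simp_all add: arc_to_ends_def)
    have "x \<in> head G ` out_arcs G (v j) \<longleftrightarrow> v j \<rightarrow>\<^bsub>G\<^esub> x" for x
      by (force simp: arcs_ends_conv)
    moreover have "x \<in> v ` neighbours j \<longleftrightarrow> v j \<rightarrow>\<^bsub>G\<^esub> x" for x
      using adj_in_verts(2)[of "v j" x] bij_v by (auto simp: neighbours_def bij_betw_def)
    ultimately show "head G ` out_arcs G (v j) = v ` neighbours j"
      by blast
  qed
  then have "out_degree G (v j) = card (v ` neighbours j)"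
    unfolding out_degree_def by (rule bij_betw_same_card)
  then show ?thesis
    using card_image[OF inj_on_subset[OF inj_v subset_UNIV]] by simp
qed

abbreviation M :: "real ^ 'n ^ 'n" where
  "M \<equiv> laplacian_matrix v G + mat 1"

text \<open>The degree on the diagonal supplies one copy of \<open>x $ j\<close> for each
  neighbour.\<close>

lemma M_mult_vec: "(M *v x) $ j = x $ j + (\<Sum>l\<in>neighbours j. x $ j - x $ l)"
proof -
  have "M $ j $ l * x $ l =
      (if l = j then x $ j + real (card (neighbours j)) * x $ j else 0)
      - (if l \<in> neighbours j then x $ l else 0)" for l
    by (auto simp: laplacian_matrix_def degree_matrix_def adjacency_matrix_def mat_def
        out_degree_eq_card_neighbours neighbours_def algebra_simps)
  then show ?thesis
    by (simp add: matrix_vector_mult_def sum_subtractf sum.If_cases)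
qed

text \<open>A discrete minimum principle, stated for arbitrary vectors because it serves twice: for
  the kernel of \<open>M\<close> and for the rows of \<open>B_matrix v G\<close>.\<close>

lemma nonneg_if_M_mult_nonneg:
  assumes "\<And>j. (M *v x) $ j \<ge> 0"
  shows "x $ j \<ge> 0"
proof -
  obtain m where m: "\<And>l. x $ m \<le> x $ l"
    using ex_is_arg_min_if_finite[of UNIV "($) x"] by (auto simp: is_arg_min_def not_less)
  have "(\<Sum>l\<in>neighbours m. x $ m - x $ l) \<le> 0"
    by (intro sum_nonpos) (simp add: m)
  with assms[of m] have "x $ m \<ge> 0"
    by (simp add: M_mult_vec)
  with m[of j] show ?thesis
    by linarith
qed

text \<open>The minimum principle, applied to a kernel vector and to its negative, shows that the
  kernel is trivial.\<close>

lemma invertible_M: "invertible M"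
proof -
  have "x = 0" if "M *v x = 0" for x
  proof (rule vec_eq_iff[THEN iffD2], rule allI)
    fix j
    have "M *v (- x) = 0"
      using that linear_neg[OF matrix_vector_mul_linear, of M x] by simp
    then have "x $ j \<ge> 0" "(- x) $ j \<ge> 0"
      using that nonneg_if_M_mult_nonneg[of x j] nonneg_if_M_mult_nonneg[of "- x" j]
      by simp_all
    then show "x $ j = 0 $ j"
      by simp
  qed
  then show ?thesis
    using matrix_left_invertible_ker invertible_left_inverse by blast
qed

lemma transpose_M: "transpose M = M"
  using graph_symmetric
  by (auto simp: transpose_def vec_eq_iff laplacian_matrix_def degree_matrix_def
      adjacency_matrix_def mat_def)

lemma B_matrix_symmetric: "B_matrix v G $ i $ j = B_matrix v G $ j $ i"
proof -
  have "transpose (B_matrix v G) $ j $ i = B_matrix v G $ j $ i"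
    unfolding B_matrix_def transpose_matrix_inv_symmetric[OF invertible_M transpose_M] ..
  then show ?thesis
    by (simp add: transpose_def)
qed

lemma M_mult_row_B: "M *v row i (B_matrix v G) = axis i 1"
proof -
  \<comment> \<open>By symmetry row \<open>i\<close> is also column \<open>i\<close>, and the
    columns are what \<open>M ** B_matrix v G = mat 1\<close> describes.\<close>
  have "row i (B_matrix v G) = B_matrix v G *v axis i 1"
    by (simp add: vec_eq_iff row_def matrix_vector_mul_component inner_axis B_matrix_symmetric)
  then show ?thesis
    using matrix_inv_mult(1)[OF invertible_M]
    by (simp add: matrix_vector_mul_assoc B_matrix_def)
qed

lemma B_matrix_eq:
  "B_matrix v G $ i $ j + (\<Sum>l\<in>neighbours j. B_matrix v G $ i $ j - B_matrix v G $ i $ l)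
    = (if j = i then 1 else 0)"
  using M_mult_vec[of "row i (B_matrix v G)" j]
  unfolding M_mult_row_B by (simp add: row_def axis_def)

lemma B_matrix_nonneg: "B_matrix v G $ i $ j \<ge> 0"
proof -
  have "row i (B_matrix v G) $ j \<ge> 0"
    by (rule nonneg_if_M_mult_nonneg) (simp only: M_mult_row_B, simp add: axis_def)
  then show ?thesis
    by (simp add: row_def)
qed

lemma B_matrix_pos:
  assumes "connected G"
  shows "B_matrix v G $ i $ j > 0"
proof (rule ccontr)
  assume "\<not> ?thesis"
  then have zero: "B_matrix v G $ i $ j = 0"
    using B_matrix_nonneg[of i j] by simp
  \<comment> \<open>At a zero entry the equation equates minus a sum of nonnegative terms with 0 or
    1, so the right side is 0 and every term vanishes.\<close>
  have zero_step: "l \<noteq> i \<and> (\<forall>k\<in>neighbours l. B_matrix v G $ i $ k = 0)"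
    if "B_matrix v G $ i $ l = 0" for l
  proof -
    have nonneg: "(\<Sum>k\<in>neighbours l. B_matrix v G $ i $ k) \<ge> 0"
      by (intro sum_nonneg B_matrix_nonneg)
    have eq: "- (\<Sum>k\<in>neighbours l. B_matrix v G $ i $ k) = (if l = i then 1 else 0)"
      using B_matrix_eq[of i l] that by (simp add: sum_negf)
    with nonneg have "l \<noteq> i" by (auto split: if_splits)
    with eq show ?thesis
      using sum_nonneg_eq_0_iff[of "neighbours l" "\<lambda>k. B_matrix v G $ i $ k"]
      by (simp add: B_matrix_nonneg)
  qed
  have "strongly_connected G"
    using symmetric_connected_imp_strongly_connected[OF sym_arcs assms] .
  then have "v j \<rightarrow>\<^sup>*\<^bsub>G\<^esub> v i"
    using v_in_verts by (auto simp: strongly_connected_def)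
  \<comment> \<open>Reachability relates vertices, not indices; quantifying over the indices of the
    end vertex makes the claim suitable for induction.\<close>
  then have "\<forall>l. v i = v l \<longrightarrow> B_matrix v G $ i $ l = 0"
  proof (induction rule: reachable_induct)
    case base
    then show ?case using zero inj_v by (auto dest: injD)
  next
    case (step x y)
    obtain k where "x = v k"
      using adj_in_verts(1)[OF step(2)] bij_v by (auto simp: bij_betw_def)
    with step(2,3) zero_step[of k] show ?case
      by (auto simp: neighbours_def)
  qed
  then show False
    using zero_step[of i] by blast
qed

text \<open>Otherwise the left side of \<open>B_matrix_eq\<close> would be a positive entry plus
  nonnegative differences, while the right side is 0.\<close>

lemma ex_neighbour_greater:
  assumes "connected G" "j \<noteq> i"
  shows "\<exists>l\<in>neighbours j. B_matrix v G $ i $ j < B_matrix v G $ i $ l"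
proof (rule ccontr)
  assume "\<not> ?thesis"
  then have "(\<Sum>l\<in>neighbours j. B_matrix v G $ i $ j - B_matrix v G $ i $ l) \<ge> 0"
    by (intro sum_nonneg) (auto simp: not_less)
  then show False
    using B_matrix_eq[of i j] B_matrix_pos[OF assms(1), of i j] assms(2) by simp
qed

lemma ex_increasing_vwalk:
  assumes "connected G" "j \<noteq> i"
  shows "\<exists>js. vwalk (map v (j # js @ [i])) G \<and>
    sorted_wrt (<) (map (\<lambda>l. B_matrix v G $ i $ l) (j # js @ [i]))"
  using assms(2)
\<comment> \<open>The measure drops in a step from \<open>j\<close> to a larger neighbour
  \<open>k\<close>, since \<open>k\<close> itself leaves the set.\<close>
proof (induction "card {l. B_matrix v G $ i $ j < B_matrix v G $ i $ l}"
    arbitrary: j rule: less_induct)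
  case less
  obtain k where k: "k \<in> neighbours j" "B_matrix v G $ i $ j < B_matrix v G $ i $ k"
    using ex_neighbour_greater[OF assms(1) less.prems] by blast
  show ?case
  proof (cases "k = i")
    case True
    with k have "vwalk (map v (j # [] @ [i])) G"
      by (auto simp: vwalk_def v_in_verts neighbours_def)
    with k True show ?thesis
      by (intro exI[of _ "[]"]) simp
  next
    case False
    have "card {l. B_matrix v G $ i $ k < B_matrix v G $ i $ l}
        < card {l. B_matrix v G $ i $ j < B_matrix v G $ i $ l}"
      using k by (intro psubset_card_mono) auto
    from less.hyps[OF this False] obtain js where
      js: "vwalk (map v (k # js @ [i])) G"
        "sorted_wrt (<) (map (\<lambda>l. B_matrix v G $ i $ l) (k # js @ [i]))"
      by blast
    have "vwalk (map v (j # (k # js) @ [i])) G"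
      using vwalk_consI[OF js(1) v_in_verts[of j]] k(1) by (simp add: neighbours_def)
    moreover have "sorted_wrt (<) (map (\<lambda>l. B_matrix v G $ i $ l) (j # (k # js) @ [i]))"
      using js(2) k(2) by auto
    ultimately show ?thesis
      by blast
  qed
qed

lemma ex_increasing_vpath:
  assumes "connected G" "j \<noteq> i"
  shows "\<exists>js. vpath (map v (j # js @ [i])) G \<and>
    sorted_wrt (<) (map (\<lambda>l. B_matrix v G $ i $ l) (j # js @ [i]))"
proof -
  obtain js where js: "vwalk (map v (j # js @ [i])) G"
      "sorted_wrt (<) (map (\<lambda>l. B_matrix v G $ i $ l) (j # js @ [i]))"
    using ex_increasing_vwalk[OF assms] by blast
  \<comment> \<open>Strictly increasing values exclude repeated indices, so the walk is already a
    path.\<close>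
  have "distinct (j # js @ [i])"
    using js(2) unfolding strict_sorted_iff distinct_map by blast
  then have "distinct (map v (j # js @ [i]))"
    unfolding distinct_map using inj_on_subset[OF inj_v subset_UNIV] by blast
  with js show ?thesis
    by blast
qed

end

theorem theorem3p6:
  fixes G :: "('a, 'b) pre_digraph" and v :: "'n::finite \<Rightarrow> 'a"
  assumes "graph G"
    and "Digraph_Component.connected G"
    and "bij_betw v UNIV (verts G)"
  shows "(\<forall>i j. j \<noteq> i \<longrightarrow>
            (\<exists>js. vpath (map v (j # js @ [i])) G \<and>
                  sorted_wrt (<) (map (\<lambda>l. B_matrix v G $ i $ l) (j # js @ [i])))) \<and>
         (\<forall>i j. j \<noteq> i \<longrightarrow>
            B_matrix v G $ i $ j < B_matrix v G $ i $ i \<and>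
            B_matrix v G $ j $ i < B_matrix v G $ i $ i)"
proof -
  interpret graph G by fact
  interpret indexed_graph G v
    by unfold_locales fact
  show ?thesis
  proof (intro conjI allI impI)
    fix i j :: 'n
    assume "j \<noteq> i"
    then show "\<exists>js. vpath (map v (j # js @ [i])) G \<and>
        sorted_wrt (<) (map (\<lambda>l. B_matrix v G $ i $ l) (j # js @ [i]))"
      by (rule ex_increasing_vpath[OF assms(2)])
    \<comment> \<open>Compare the first and the last entry of the increasing chain.\<close>
    then show "B_matrix v G $ i $ j < B_matrix v G $ i $ i"
      by auto
    then show "B_matrix v G $ j $ i < B_matrix v G $ i $ i"
      by (simp add: B_matrix_symmetric[of j i])
  qed
qed

end
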